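(* Let $M$ be a Hilbertian field. Then for a fixed $m\in M$ with $m^2+3m+9\neq0$ there exist infinitely many $n\in M$ such that the splitting fields over $M$ of $X^3-mX^2-(m+3)X-1$ and of $X^3-nX^2-(n+3)X-1$ coincide.
   Context: Splitting fields are taken in a fixed algebraic closure of $M$. The discriminant of $X^3-mX^2-(m+3)X-1$ is $(m^2+3m+9)^2$. *)

theory Defs
  imports
    "HOL-Algebra.Generated_Fields"
    "HOL-Algebra.Algebraic_Closure_Type"
    "HOL-Computational_Algebra.Computational_Algebra"
begin

text \<open>
  A polynomial over a field is separable if it has only simple roots in an algebraic closure.
\<close>
definition separable_poly :: "'a :: field poly \<Rightarrow> bool" where
  "separable_poly f \<longleftrightarrow> rsquarefree (map_poly to_ac f)"

text \<open>
  For \<open>f(T,X) \<in> K(T)[X]\<close>, where \<open>K(T)\<close> is the fraction field of \<open>K[T]\<close>,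
  \<open>specializes_to f a h\<close> means that \<open>f(a,X)\<close> is defined (no coefficient of \<open>f\<close> has a
  pole at \<open>T = a\<close>) and equals \<open>h \<in> K[X]\<close>. A coefficient regular at \<open>a\<close> may be written
  with any denominator that does not vanish at \<open>a\<close>, so \<open>h\<close> is unique if it exists.
\<close>
definition specializes_to :: "'a :: field poly fract poly \<Rightarrow> 'a \<Rightarrow> 'a poly \<Rightarrow> bool" where
  "specializes_to f a h \<longleftrightarrow>
     (\<forall>i. \<exists>p q. poly.coeff f i = Fract p q \<and> poly q a \<noteq> 0 \<and>
                poly.coeff h i = poly p a / poly q a)"

text \<open>
  The Hilbert set \<open>H\<^sub>K(f\<^sub>1,\<dots>,f\<^sub>r; g)\<close> with \<open>F = {f\<^sub>1,\<dots>,f\<^sub>r}\<close>.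
\<close>
definition hilbert_set :: "'a :: field poly fract poly set \<Rightarrow> 'a poly \<Rightarrow> 'a set" where
  "hilbert_set F g =
     {a. poly g a \<noteq> 0 \<and>
         (\<forall>f\<in>F. \<exists>h. specializes_to f a h \<and> Factorial_Ring.irreducible h)}"

text \<open>
  A field \<open>K\<close> is Hilbertian if every separable Hilbert subset of \<open>K\<close> is nonempty. As usual
  (Fried--Jarden), separability of the \<open>f\<^sub>i\<close> is required, so that the notion is the standard
  one in positive characteristic as well; in characteristic 0 this is no restriction. One
  parameter \<open>T\<close> suffices: it is a theorem that nonemptiness of the Hilbert sets in several
  parameters follows.
\<close>
definition hilbertian :: "'a :: field itself \<Rightarrow> bool" where
  "hilbertian (_ :: 'a itself) \<longleftrightarrow>
     (\<forall>(F :: 'a poly fract poly set) (g :: 'a poly).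
        finite F \<and> (\<forall>f\<in>F. Factorial_Ring.irreducible f \<and> separable_poly f) \<and> g \<noteq> 0
        \<longrightarrow> hilbert_set F g \<noteq> {})"

text \<open>
  The splitting field over \<open>M\<close> of \<open>p \<in> M[X]\<close> inside the fixed algebraic closure
  \<^typ>\<open>'a alg_closure\<close> of \<open>M\<close>: the subfield generated by (the image of) \<open>M\<close> and the
  roots of \<open>p\<close>.
\<close>
definition splitting_field :: "'a :: field poly \<Rightarrow> 'a alg_closure set" where
  "splitting_field p =
     generate_field ring_of_type_algebra
       (range to_ac \<union> {x. poly (map_poly to_ac p) x = 0})"

text \<open>The polynomial \<open>X\<^sup>3 - mX\<^sup>2 - (m+3)X - 1\<close>.\<close>
definition simplest_cubic :: "'a :: field \<Rightarrow> 'a poly" where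
  "simplest_cubic m = [:-1, -(m + 3), -m, 1:]"

end

theory Submission
  imports Defs
begin

text \<open>
  The roots of a simplest cubic are permuted cyclically by \<open>\<sigma>(x) = -1/(x + 1)\<close>. Apart
  from the identity, the Moebius transformations commuting with \<open>\<sigma>\<close> are
  \<open>x \<mapsto> (t x - 1)/(x + t + 1)\<close> with \<open>t\<^sup>2 + t + 1 \<noteq> 0\<close>. Such a map with
  \<open>t \<in> M\<close> therefore sends the roots of the cubic with parameter \<open>m\<close> to the roots of the
  cubic with another parameter \<open>n \<in> M\<close>, a rational function of \<open>t\<close>, and, being invertible over
  \<open>M\<close>, it preserves the splitting field. If \<open>m\<^sup>2 + 3m + 9 \<noteq> 0\<close>, this rational function
  takes each value only finitely often. So the only property of a Hilbertian field that matters is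
  that it is infinite.
\<close>

definition twist_num :: "'a :: field \<Rightarrow> 'a \<Rightarrow> 'a" where
  "twist_num t m = (t ^ 3 - 3 * t - 1) * m - 9 * (t ^ 2 + t)"

text \<open>Up to sign the cubic with parameter \<open>m\<close> at the pole \<open>- 1 - t\<close>
  of the Moebius map, that is, the product of \<open>x + t + 1\<close> over its roots
  \<open>x\<close>, with multiplicity.\<close>

definition twist_den :: "'a :: field \<Rightarrow> 'a \<Rightarrow> 'a" where
  "twist_den t m = (t ^ 2 + t) * m + t ^ 3 + 3 * t ^ 2 - 1"

definition twist :: "'a :: field \<Rightarrow> 'a \<Rightarrow> 'a" where
  "twist t m = twist_num t m / twist_den t m"

text \<open>With no polynomials to keep irreducible, a Hilbert set is the set of non-zeros of
  \<open>g\<close>. Over a finite field the product of all \<open>X - a\<close> is a nonzero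
  polynomial that vanishes everywhere.\<close>

lemma infinite_UNIV_if_hilbertian:
  assumes "hilbertian TYPE('a :: field)"
  shows "infinite (UNIV :: 'a set)"
proof
  assume fin: "finite (UNIV :: 'a set)"
  define g :: "'a poly" where "g = (\<Prod>a\<in>UNIV. [:-a, 1:])"
  have "g \<noteq> 0"
    using fin by (simp add: g_def)
  then have "hilbert_set {} g \<noteq> {}"
    using assms unfolding hilbertian_def by blast
  moreover have "poly g a = 0" for a
    using fin by (auto simp: g_def poly_prod)
  ultimately show False
    by (auto simp: hilbert_set_def)
qed

lemma poly_simplest_cubic:
  "poly (simplest_cubic m) x = x ^ 3 - m * x ^ 2 - (m + 3) * x - 1"
  by (simp add: simplest_cubic_def algebra_simps power2_eq_square power3_eq_cube)

lemma map_poly_simplest_cubic [simp]: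
  "map_poly to_ac (simplest_cubic m) = simplest_cubic (to_ac m)"
  by (simp add: simplest_cubic_def map_poly_pCons)

lemma to_ac_twist_den: "to_ac (twist_den t m) = twist_den (to_ac t) (to_ac m)"
  by (simp add: twist_den_def)

lemma to_ac_twist: "to_ac (twist t m) = twist (to_ac t) (to_ac m)"
  by (simp add: twist_def twist_num_def twist_den_def)

section \<open>Generated fields in type-class arithmetic\<close>

lemma generate_field_subset:
  assumes "S \<subseteq> generate_field R T"
  shows "generate_field R S \<subseteq> generate_field R T"
proof
  fix x assume "x \<in> generate_field R S"
  then show "x \<in> generate_field R T"
    by induction (use assms in \<open>auto intro: generate_field.intros\<close>)
qed

context
  fixes H :: "'a :: field set"
begin

interpretation R: field "ring_of_type_algebra :: 'a ring"
  by (rule field_from_type_algebra)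

lemma generate_field_1: "1 \<in> generate_field ring_of_type_algebra H"
  using generate_field.one[of ring_of_type_algebra H] by (simp add: ring_of_type_algebra_def)

lemma generate_field_add:
  "x \<in> generate_field ring_of_type_algebra H \<Longrightarrow> y \<in> generate_field ring_of_type_algebra H
    \<Longrightarrow> x + y \<in> generate_field ring_of_type_algebra H"
  using generate_field.eng_add[of x ring_of_type_algebra H y]
  by (simp add: ring_of_type_algebra_def)

lemma generate_field_mult:
  "x \<in> generate_field ring_of_type_algebra H \<Longrightarrow> y \<in> generate_field ring_of_type_algebra H
    \<Longrightarrow> x * y \<in> generate_field ring_of_type_algebra H"
  using generate_field.eng_mult[of x ring_of_type_algebra H y]
  by (simp add: ring_of_type_algebra_def)

lemma generate_field_uminus:
  assumes "x \<in> generate_field ring_of_type_algebra H"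
  shows "- x \<in> generate_field ring_of_type_algebra H"
proof -
  have "\<ominus>\<^bsub>ring_of_type_algebra\<^esub> x = - x"
    by (rule R.minus_equality) (auto simp: ring_of_type_algebra_def)
  then show ?thesis
    using generate_field.a_inv[OF assms] by simp
qed

lemma generate_field_diff:
  "x \<in> generate_field ring_of_type_algebra H \<Longrightarrow> y \<in> generate_field ring_of_type_algebra H
    \<Longrightarrow> x - y \<in> generate_field ring_of_type_algebra H"
  using generate_field_add[of x "- y"] generate_field_uminus[of y] by simp

lemma generate_field_inverse:
  assumes "x \<in> generate_field ring_of_type_algebra H" "x \<noteq> 0"
  shows "inverse x \<in> generate_field ring_of_type_algebra H"
proof -
  have "inv\<^bsub>ring_of_type_algebra\<^esub> x = inverse x"
    by (rule R.comm_inv_char) (use assms(2) in \<open>auto simp: ring_of_type_algebra_def\<close>)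
  then show ?thesis
    using generate_field.m_inv[OF assms(1)] assms(2) by (simp add: ring_of_type_algebra_def)
qed

lemma generate_field_divide:
  "x \<in> generate_field ring_of_type_algebra H \<Longrightarrow> y \<in> generate_field ring_of_type_algebra H
    \<Longrightarrow> y \<noteq> 0 \<Longrightarrow> x / y \<in> generate_field ring_of_type_algebra H"
  using generate_field_mult[of x "inverse y"] generate_field_inverse[of y]
  by (simp add: field_simps)

end

lemmas generate_field_closed =
  generate_field_1 generate_field_add generate_field_mult generate_field_diff
  generate_field_divide

section \<open>Moebius maps acting on roots, parameters and splitting fields\<close>

lemma simplest_cubic_root_denom_nonzero:
  fixes m t x :: "'a :: field"
  assumes root: "poly (simplest_cubic m) x = 0" and den: "twist_den t m \<noteq> 0"
  shows "x + t + 1 \<noteq> 0"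
proof
  assume "x + t + 1 = 0"
  then have t: "t = - x - 1"
    by (simp add: algebra_simps eq_neg_iff_add_eq_0)
  have "twist_den t m = - poly (simplest_cubic m) x"
    unfolding t twist_den_def poly_simplest_cubic
    by (simp add: algebra_simps power2_eq_square power3_eq_cube)
  with root den show False
    by simp
qed

text \<open>
  With \<open>g = x\<^sup>3 - 3x - 1\<close> and \<open>h = x(x + 1)\<close>, the cubic with parameter \<open>m\<close> is \<open>g - m h\<close>.
  The Moebius map acts linearly on the span of the homogenizations of \<open>g\<close> and \<open>h\<close>
  with matrix entries read off from \<open>twist_num\<close> and \<open>twist_den\<close>.
\<close>
lemma simplest_cubic_moebius_root:
  fixes m t x :: "'a :: field"
  assumes root: "poly (simplest_cubic m) x = 0" and den: "twist_den t m \<noteq> 0"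
  shows "poly (simplest_cubic (twist t m)) ((t * x - 1) / (x + t + 1)) = 0"
proof -
  define u v D N where "u = t * x - 1" and "v = x + t + 1"
    and "D = twist_den t m" and "N = twist_num t m"
  have v: "v \<noteq> 0"
    unfolding v_def using assms by (rule simplest_cubic_root_denom_nonzero)
  have D: "D \<noteq> 0"
    using den by (simp add: D_def)
  \<comment> \<open>The image root is kept as the homogeneous pair \<open>u\<close>,
    \<open>v\<close>, so this is a polynomial identity. The factor is the cube of the determinant
    \<open>t ^ 2 + t + 1\<close> of the Moebius map.\<close>
  have "D * u ^ 3 - N * u ^ 2 * v - (N + 3 * D) * u * v ^ 2 - D * v ^ 3 =
      (t ^ 2 + t + 1) ^ 3 * poly (simplest_cubic m) x"
    unfolding u_def v_def D_def N_def twist_den_def twist_num_def poly_simplest_cubic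
    by (simp add: algebra_simps power2_eq_square power3_eq_cube)
  then have hom: "D * u ^ 3 - N * u ^ 2 * v - (N + 3 * D) * u * v ^ 2 - D * v ^ 3 = 0"
    using root by simp
  define n y where "n = N / D" and "y = u / v"
  have N: "N = n * D" and u: "u = y * v"
    using v D by (simp_all add: n_def y_def)
  have "D * v ^ 3 * poly (simplest_cubic n) y =
      D * u ^ 3 - N * u ^ 2 * v - (N + 3 * D) * u * v ^ 2 - D * v ^ 3"
    unfolding N u poly_simplest_cubic
    by (simp add: algebra_simps power2_eq_square power3_eq_cube)
  with hom have "poly (simplest_cubic n) y = 0"
    using v D by simp
  then show ?thesis
    by (simp add: n_def y_def u_def v_def D_def N_def twist_def)
qed

lemma splitting_field_subset_twist:
  fixes m t :: "'a :: field"
  assumes den: "twist_den t m \<noteq> 0" and q: "t ^ 2 + t + 1 \<noteq> 0"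
  shows "splitting_field (simplest_cubic m) \<subseteq> splitting_field (simplest_cubic (twist t m))"
proof -
  define n where "n = twist t m"
  define \<tau> where "\<tau> = to_ac t"
  have base: "to_ac a \<in> splitting_field (simplest_cubic n)" for a
    unfolding splitting_field_def by (auto intro: generate_field.incl)
  have "x \<in> splitting_field (simplest_cubic n)"
    if x: "poly (simplest_cubic (to_ac m)) x = 0" for x
  proof -
    define y where "y = (\<tau> * x - 1) / (x + \<tau> + 1)"
    have den': "twist_den \<tau> (to_ac m) \<noteq> 0"
      using den by (simp add: \<tau>_def flip: to_ac_twist_den)
    have v: "x + \<tau> + 1 \<noteq> 0"
      using x den' by (rule simplest_cubic_root_denom_nonzero)
    have "poly (simplest_cubic (to_ac n)) y = 0"
      using simplest_cubic_moebius_root[OF x den'] by (simp add: y_def n_def \<tau>_def to_ac_twist)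
    then have y: "y \<in> splitting_field (simplest_cubic n)"
      unfolding splitting_field_def by (auto intro: generate_field.incl)
    have q': "\<tau> ^ 2 + \<tau> + 1 \<noteq> 0"
    proof -
      have "\<tau> ^ 2 + \<tau> + 1 = to_ac (t ^ 2 + t + 1)"
        by (simp add: \<tau>_def)
      with q show ?thesis
        by (simp only: to_ac_eq_0_iff not_False_eq_True)
    qed
    have yv: "y * (x + \<tau> + 1) = \<tau> * x - 1"
      using v by (simp add: y_def)
    \<comment> \<open>The nonzero determinant keeps \<open>y\<close> away from the pole
      \<open>\<tau>\<close> of the inverse map, which then expresses \<open>x\<close> rationally in
      \<open>y\<close> and \<open>\<tau>\<close>.\<close>
    have "(\<tau> - y) * (x + \<tau> + 1) = \<tau> ^ 2 + \<tau> + 1"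
      unfolding left_diff_distrib yv by (simp add: algebra_simps power2_eq_square)
    with q' have w: "\<tau> - y \<noteq> 0"
      by auto
    have "x * (\<tau> - y) = (\<tau> + 1) * y + 1"
      using yv by (simp add: algebra_simps)
    with w have "x = ((\<tau> + 1) * y + 1) / (\<tau> - y)"
      by (simp add: eq_divide_eq)
    also have "\<dots> \<in> splitting_field (simplest_cubic n)"
      using y base[of t] w unfolding splitting_field_def \<tau>_def
      by (intro generate_field_closed) auto
    finally show ?thesis .
  qed
  with base show ?thesis
    unfolding n_def splitting_field_def[of "simplest_cubic m"]
      splitting_field_def[of "simplest_cubic (twist t m)"]
    by (intro generate_field_subset) (auto simp: splitting_field_def)
qed

text \<open>Replacing \<open>t\<close> by \<open>- 1 - t\<close> inverts the Moebius map. On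
  parameters, the two linear actions compose to the scalar \<open>- ((t ^ 2 + t + 1) ^ 3)\<close>,
  which cancels in the quotient.\<close>

lemma twist_inverse:
  fixes m t :: "'a :: field"
  assumes den: "twist_den t m \<noteq> 0" and q: "t ^ 2 + t + 1 \<noteq> 0"
  shows "twist_den (- 1 - t) (twist t m) \<noteq> 0" "twist (- 1 - t) (twist t m) = m"
proof -
  define D N where "D = twist_den t m" and "N = twist_num t m"
  have D: "D \<noteq> 0"
    using den by (simp add: D_def)
  have n: "twist t m * D = N"
    using D by (simp add: twist_def D_def N_def)
  have d: "twist_den (- 1 - t) (twist t m) * D = - ((t ^ 2 + t + 1) ^ 3)"
  proof -
    have "twist_den (- 1 - t) (twist t m) * D =
        (t ^ 2 + t) * (twist t m * D) - (t ^ 3 - 3 * t - 1) * D"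
      unfolding twist_den_def[of "- 1 - t"]
    by (simp add: algebra_simps power2_eq_square power3_eq_cube)
    also have "\<dots> = - ((t ^ 2 + t + 1) ^ 3)"
      unfolding n unfolding D_def N_def twist_den_def twist_num_def
    by (simp add: algebra_simps power2_eq_square power3_eq_cube)
    finally show ?thesis .
  qed
  then show nz: "twist_den (- 1 - t) (twist t m) \<noteq> 0"
    using q by auto
  have "twist_num (- 1 - t) (twist t m) * D =
      - (t ^ 3 + 3 * t ^ 2 - 1) * (twist t m * D) - 9 * (t ^ 2 + t) * D"
    unfolding twist_num_def[of "- 1 - t"]
    by (simp add: algebra_simps power2_eq_square power3_eq_cube)
  also have "\<dots> = - ((t ^ 2 + t + 1) ^ 3) * m"
    unfolding n unfolding D_def N_def twist_den_def twist_num_def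
    by (simp add: algebra_simps power2_eq_square power3_eq_cube)
  also have "\<dots> = twist_den (- 1 - t) (twist t m) * m * D"
    by (simp add: d[symmetric])
  finally have "twist_num (- 1 - t) (twist t m) = m * twist_den (- 1 - t) (twist t m)"
    using D by simp
  with nz show "twist (- 1 - t) (twist t m) = m"
    unfolding twist_def[of "- 1 - t"] by simp
qed

lemma splitting_field_twist:
  fixes m t :: "'a :: field"
  assumes den: "twist_den t m \<noteq> 0" and q: "t ^ 2 + t + 1 \<noteq> 0"
  shows "splitting_field (simplest_cubic m) = splitting_field (simplest_cubic (twist t m))"
proof
  \<comment> \<open>The reverse inclusion is the one already proved, applied to the inverse map; the
    determinant is invariant under this change of \<open>t\<close>.\<close>
  have "(- 1 - t) ^ 2 + (- 1 - t) + 1 = t ^ 2 + t + 1"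
    by (simp add: algebra_simps power2_eq_square)
  with q have "(- 1 - t) ^ 2 + (- 1 - t) + 1 \<noteq> 0"
    by (simp only: not_False_eq_True)
  from splitting_field_subset_twist[OF twist_inverse(1)[OF assms] this]
  show "splitting_field (simplest_cubic (twist t m)) \<subseteq> splitting_field (simplest_cubic m)"
    by (simp only: twist_inverse(2)[OF assms])
qed (rule splitting_field_subset_twist[OF assms])

text \<open>For \<open>c = m\<close> the cubic terms cancel and the leading coefficient becomes \<open>-(m\<^sup>2 + 3m + 9)\<close>.\<close>
lemma finite_twist_fibre:
  fixes m c :: "'a :: field"
  assumes "m ^ 2 + 3 * m + 9 \<noteq> 0"
  shows "finite {t. twist_num t m = c * twist_den t m}"
proof -
  define p where "p = [:c - m, - 3 * m - 9 - c * m, - 9 - c * m - 3 * c, m - c:]"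
  have "p \<noteq> 0"
  proof
    assume "p = 0"
    then have "m - c = 0" "- 9 - c * m - 3 * c = 0"
      by (simp_all only: p_def pCons_eq_0_iff)
    moreover from this have "m ^ 2 + 3 * m + 9 = - (- 9 - c * m - 3 * c)"
      by (simp add: algebra_simps power2_eq_square)
    ultimately have "m ^ 2 + 3 * m + 9 = 0"
      by (simp only: minus_zero)
    with assms show False ..
  qed
  then have "finite {t. poly p t = 0}"
    by (rule poly_roots_finite)
  moreover have "poly p t = twist_num t m - c * twist_den t m" for t
    unfolding p_def twist_num_def twist_den_def poly_pCons poly_0
    by (simp add: algebra_simps power2_eq_square power3_eq_cube)
  ultimately show ?thesis
    by (simp only: right_minus_eq)
qed

lemma finite_twist_den_roots: "finite {t :: 'a :: field. twist_den t m = 0}"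
proof -
  have "finite {t. poly [:- 1, m, m + 3, 1:] t = 0}"
    by (rule poly_roots_finite) simp
  moreover have "poly [:- 1, m, m + 3, 1:] t = twist_den t m" for t
    by (simp add: twist_den_def algebra_simps power2_eq_square power3_eq_cube)
  ultimately show ?thesis
    by (simp only:)
qed

theorem corollary5p5:
  fixes m :: "'a :: field"
  assumes "hilbertian TYPE('a)"
    and "m ^ 2 + 3 * m + 9 \<noteq> 0"
  shows "infinite {n :: 'a.
           splitting_field (simplest_cubic m) = splitting_field (simplest_cubic n)}"
proof
  let ?N = "{n. splitting_field (simplest_cubic m) = splitting_field (simplest_cubic n)}"
  assume fin: "finite ?N"
  have "finite {t :: 'a. poly [:1, 1, 1:] t = 0}"
    by (rule poly_roots_finite) simp
  moreover have "poly [:1, 1, 1:] t = t ^ 2 + t + 1" for t :: 'a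
    by (simp add: algebra_simps power2_eq_square)
  ultimately have "finite {t :: 'a. t ^ 2 + t + 1 = 0}"
    by (simp only:)
  moreover have "finite (\<Union>c\<in>?N. {t. twist_num t m = c * twist_den t m})"
    using fin finite_twist_fibre[OF assms(2)] by blast
  \<comment> \<open>Every \<open>t\<close> outside two finite exceptional sets lies in the fibre
    over its own twist, a member of \<open>?N\<close>. If \<open>?N\<close> were finite, finitely
    many finite sets would cover the field.\<close>
  moreover have "(UNIV :: 'a set) \<subseteq> {t. t ^ 2 + t + 1 = 0} \<union> {t. twist_den t m = 0} \<union>
      (\<Union>c\<in>?N. {t. twist_num t m = c * twist_den t m})"
  proof
    fix t :: 'a
    have "twist t m \<in> ?N" "twist_num t m = twist t m * twist_den t m"
      if "t ^ 2 + t + 1 \<noteq> 0" "twist_den t m \<noteq> 0"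
      using splitting_field_twist[OF that(2,1)] that(2) by (simp_all add: twist_def)
    then show "t \<in> {t. t ^ 2 + t + 1 = 0} \<union> {t. twist_den t m = 0} \<union>
      (\<Union>c\<in>?N. {t. twist_num t m = c * twist_den t m})"
      by blast
  qed
  ultimately have "finite (UNIV :: 'a set)"
    using finite_twist_den_roots[of m] by (meson finite_UnI finite_subset)
  with infinite_UNIV_if_hilbertian[OF assms(1)] show False
    by contradiction
qed

end
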